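(* There is no stable base $\mathcal{B}$ where the law $\neg_\rho(A\wedge B)\ \vdash_\rho\ \neg_\rho A\vee\neg_\rho B$ holds (i.e. is true for all algorithmic statements $A,B$) for all $\mathcal{B}$-libraries $\rho$. In particular, no stable base contains Rule $P_{11}$, the rule implementing the diagram $\neg_\rho(A\wedge B)\,/\,\neg_\rho A\vee\neg_\rho B$.
   Context: Framework. Algorithms are recursive algorithms in a fixed standard model. A datum is anything that can be input to an algorithm; data include natural numbers and algorithms, and every finite list of data is a datum. Every algorithm accepts exactly one input datum and either does not halt or halts with exactly one output datum. Every datum has a positive integer size, only finitely many data have a given size, and the size of a list is strictly greater than the sum of the sizes of its items. A process is a pair (algorithm, input). Every halting process has a positive integer runtime; if a process runs subprocesses in its execution, its runtime is strictly greater than the sum of the runtimes of the halting subprocesses. An algorithmic statement is a datum $[\alpha,u,v]$ with $\alpha$ an algorithm, asserting that $\alpha$ with input $u$ halts with output $v$; it is true if this is so and false otherwise, and it is directly false if $\alpha$ halts on $u$ with an output different from $v$. To say that an algorithmic statement holds is to say that it is true. $\mathcal{F}$ denotes the false statement $[\mathrm{identity},0,1]$, where $\mathrm{identity}$ outputs a copy of its input. Rules and libraries. An algorithmic sequence is an algorithm $\rho$ that halts on every positive integer $n$; its output is written $\rho_n$. A rule is an algorithm which, on every input $[H,\rho,m]$ with $H$ a finite list of algorithmic statements (hypothesis list), $\rho$ an algorithmic sequence (nominal library) and $m$ a positive integer (resource integer), halts and outputs a list of algorithmic statements (conclusion list) having $H$ as an initial sublist, and which is monotone: if $m'\ge m$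 and every item of $H$ is an item of $H'$, then every item of the output on $[H,\rho,m]$ is an item of the output on $[H',\rho,m']$. A library is an algorithmic sequence $\rho$ such that every $\rho_n$ is a rule (not necessarily distinct); the $\rho_n$ are the rules contained in $\rho$. A rule is $\rho$-valid if for every list $H$ of true statements and every $m$, its output on $[H,\rho,m]$ consists only of true statements. A library $\rho$ is valid if all its rules are $\rho$-valid. Bases. A base is a set $\mathcal{B}$ of rules that is finite or is the set of terms of a library. A $\mathcal{B}$-library is a library containing all rules of $\mathcal{B}$. A $\mathcal{B}$-library $\rho$ is valid outside $\mathcal{B}$ if every rule in $\rho$ which is not in $\mathcal{B}$ is $\rho$-valid. A base $\mathcal{B}$ is stable if every $\mathcal{B}$-library that is valid outside $\mathcal{B}$ is valid. Deduction. Fix a recursive bijection $f:\mathbb{N}_+\to\mathbb{N}_+\times\mathbb{N}_+$. The algorithm $\mathrm{deduce}$, on input $[\Gamma,\rho,B]$ ($\Gamma$ a list of algorithmic statements, $\rho$ a library, $B$ an algorithmic statement), computes lists $H_0=\Gamma,H_1,H_2,\dots$, where for $i>0$ with $f(i)=(k,m)$ the list $H_i$ is the output of $\rho_k$ on $[H_{i-1},\rho,m]$; after computing each $H_i$ it checks whether $B$ is on $H_i$, outputs $1$ if so, and otherwise continues. The algorithmic statement $[\mathrm{deduce},[\Gamma,\rho,B],1]$ is denoted $\Gamma\vdash_\rho B$ (the notation is used for any datum $\rho$), and $A_1,\dots,A_n\vdash_\rho B$ means this with $\Gamma=[A_1,\dots,A_n]$. $A\Rightarrow_\rho B$ denotes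 $A\vdash_\rho B$, and $\neg_\rho A$ denotes $A\Rightarrow_\rho\mathcal{F}$. Connectives. The algorithm $\mathrm{and}$ on input $[A,B]$ (two algorithmic statements) outputs $1$ if both are true, $0$ if either is directly false, and otherwise does not halt; $A\wedge B$ denotes $[\mathrm{and},[A,B],1]$. The algorithm $\mathrm{or}$ on $[A,B]$ outputs $1$ if $A$ or $B$ is true, $0$ if both are directly false, and otherwise does not halt; $A\vee B$ denotes $[\mathrm{or},[A,B],1]$. The negation $\neg_\rho$ binds more tightly than $\wedge,\vee$. Rule diagrams. A rule implementing "$X_1,\dots,X_r\,/\,Y$" is the algorithm which on input $[H,\rho,m]$ outputs $H$ with $Y$ appended for every instance (letters ranging over algorithmic statements) whose premises $X_1,\dots,X_r$ are all on $H$; the $\rho$ in $\neg_\rho$ is the nominal library in the input. *)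

theory Defs
  imports Main "HOL-Library.Multiset"
begin

text \<open>Kleene's partial recursive functions on the natural numbers.
  \<open>rec_eval p xs y\<close> means that the function described by \<open>p\<close> is defined at \<open>xs\<close> with value \<open>y\<close>.\<close>

datatype recf = Zero | Succ | Proj nat | Comp recf "recf list" | PrimRec recf recf | Mu recf

inductive rec_eval :: "recf \<Rightarrow> nat list \<Rightarrow> nat \<Rightarrow> bool" where
  Zero: "rec_eval Zero xs 0"
| Succ: "rec_eval Succ [x] (Suc x)"
| Proj: "i < length xs \<Longrightarrow> rec_eval (Proj i) xs (xs ! i)"
| Comp: "length ys = length gs \<Longrightarrow> (\<forall>i<length gs. rec_eval (gs ! i) xs (ys ! i)) \<Longrightarrow>
    rec_eval f ys z \<Longrightarrow> rec_eval (Comp f gs) xs z"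
| PrimRec_0: "rec_eval f xs y \<Longrightarrow> rec_eval (PrimRec f g) (0 # xs) y"
| PrimRec_Suc: "rec_eval (PrimRec f g) (n # xs) r \<Longrightarrow> rec_eval g (n # r # xs) y \<Longrightarrow>
    rec_eval (PrimRec f g) (Suc n # xs) y"
| Mu: "rec_eval f (n # xs) 0 \<Longrightarrow> (\<forall>i<n. \<exists>y. rec_eval f (i # xs) (Suc y)) \<Longrightarrow>
    rec_eval (Mu f) xs n"

definition recursive_fun :: "(nat \<Rightarrow> nat) \<Rightarrow> bool" where
  "recursive_fun h \<longleftrightarrow> (\<exists>p. \<forall>n. rec_eval p [n] (h n))"

definition recursive_set :: "nat set \<Rightarrow> bool" where
  "recursive_set S \<longleftrightarrow> recursive_fun (\<lambda>n. if n \<in> S then 1 else 0)"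


text \<open>The fixed model of computation is a parameter: the type \<open>'d\<close> is the type of all data,
  \<open>run M a u\<close> is the output of the algorithm \<open>a\<close> on input \<open>u\<close> (\<open>None\<close> if it does not halt), and
  \<open>subprocs M a u\<close> collects, with multiplicity, the subprocesses run during the execution of the
  (halting) process \<open>(a, u)\<close>. The values of \<open>run\<close>, \<open>runtime\<close> and \<open>subprocs\<close> are meaningless when
  \<open>a\<close> is not an algorithm. The field \<open>sched\<close> is the bijection used by \<open>deduce\<close>; only its values
  at positive numbers matter.\<close>

record 'd model =
  num :: "nat \<Rightarrow> 'd"
  lst :: "'d list \<Rightarrow> 'd"
  algs :: "'d set"
  run :: "'d \<Rightarrow> 'd \<Rightarrow> 'd option"
  dsize :: "'d \<Rightarrow> nat"
  runtime :: "'d \<Rightarrow> 'd \<Rightarrow> nat"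
  subprocs :: "'d \<Rightarrow> 'd \<Rightarrow> ('d \<times> 'd) multiset"
  identity_alg :: 'd
  and_alg :: 'd
  or_alg :: 'd
  deduce_alg :: 'd
  sched :: "nat \<Rightarrow> nat \<times> nat"

definition halts :: "'d model \<Rightarrow> 'd \<Rightarrow> 'd \<Rightarrow> bool" where
  "halts M a u \<longleftrightarrow> a \<in> algs M \<and> run M a u \<noteq> None"

text \<open>The algorithms of the model are the recursive ones: with respect to some Goedel numbering of
  the data in which numerals, lists and algorithms are effectively recognisable and numerals and
  lists can be effectively built, the algorithms compute exactly the partial recursive functions,
  and they are uniformly computable (there is a universal function).\<close>

definition recursive_model :: "'d model \<Rightarrow> bool" where
  "recursive_model M \<longleftrightarrow> (\<exists>code :: 'd \<Rightarrow> nat. bij code \<and>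
     recursive_fun (\<lambda>n. code (num M n)) \<and>
     (\<exists>p. \<forall>x xs. rec_eval p [code x, code (lst M xs)] (code (lst M (x # xs)))) \<and>
     recursive_set (code ` range (num M)) \<and>
     recursive_set (code ` range (lst M)) \<and>
     recursive_set (code ` algs M) \<and>
     (\<exists>p. \<forall>a\<in>algs M. \<forall>u v. run M a u = Some v \<longleftrightarrow> rec_eval p [code a, code u] (code v)) \<and>
     (\<forall>p. \<exists>a\<in>algs M. \<forall>u v. run M a u = Some v \<longleftrightarrow> rec_eval p [code u] (code v)))"


definition stmt :: "'d model \<Rightarrow> 'd \<Rightarrow> bool" where
  "stmt M A \<longleftrightarrow> (\<exists>a\<in>algs M. \<exists>u v. A = lst M [a, u, v])"

definition true_stmt :: "'d model \<Rightarrow> 'd \<Rightarrow> bool" where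
  "true_stmt M A \<longleftrightarrow> (\<exists>a\<in>algs M. \<exists>u v. A = lst M [a, u, v] \<and> run M a u = Some v)"

definition directly_false :: "'d model \<Rightarrow> 'd \<Rightarrow> bool" where
  "directly_false M A \<longleftrightarrow>
     (\<exists>a\<in>algs M. \<exists>u v w. A = lst M [a, u, v] \<and> run M a u = Some w \<and> w \<noteq> v)"

definition falsum :: "'d model \<Rightarrow> 'd" where
  "falsum M = lst M [identity_alg M, num M 0, num M 1]"


definition alg_seq :: "'d model \<Rightarrow> 'd \<Rightarrow> bool" where
  "alg_seq M \<rho> \<longleftrightarrow> \<rho> \<in> algs M \<and> (\<forall>n>0. halts M \<rho> (num M n))"

definition seq_term :: "'d model \<Rightarrow> 'd \<Rightarrow> nat \<Rightarrow> 'd" where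
  "seq_term M \<rho> n = the (run M \<rho> (num M n))"

definition seq_terms :: "'d model \<Rightarrow> 'd \<Rightarrow> 'd set" where
  "seq_terms M \<rho> = {seq_term M \<rho> n | n. n > 0}"

definition rule_input :: "'d model \<Rightarrow> 'd list \<Rightarrow> 'd \<Rightarrow> nat \<Rightarrow> 'd" where
  "rule_input M H \<rho> m = lst M [lst M H, \<rho>, num M m]"

definition rule_output :: "'d model \<Rightarrow> 'd \<Rightarrow> 'd list \<Rightarrow> 'd \<Rightarrow> nat \<Rightarrow> 'd list" where
  "rule_output M r H \<rho> m = (THE L. run M r (rule_input M H \<rho> m) = Some (lst M L))"

definition is_rule :: "'d model \<Rightarrow> 'd \<Rightarrow> bool" where
  "is_rule M r \<longleftrightarrow> r \<in> algs M \<and>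
     (\<forall>H \<rho> m. (\<forall>A\<in>set H. stmt M A) \<and> alg_seq M \<rho> \<and> m > 0 \<longrightarrow>
        (\<exists>C. (\<forall>A\<in>set C. stmt M A) \<and> run M r (rule_input M H \<rho> m) = Some (lst M (H @ C)))) \<and>
     (\<forall>H H' \<rho> m m'. (\<forall>A\<in>set H. stmt M A) \<and> (\<forall>A\<in>set H'. stmt M A) \<and> alg_seq M \<rho> \<and>
        0 < m \<and> m \<le> m' \<and> set H \<subseteq> set H' \<longrightarrow>
        set (rule_output M r H \<rho> m) \<subseteq> set (rule_output M r H' \<rho> m'))"

definition is_library :: "'d model \<Rightarrow> 'd \<Rightarrow> bool" where
  "is_library M \<rho> \<longleftrightarrow> alg_seq M \<rho> \<and> (\<forall>r\<in>seq_terms M \<rho>. is_rule M r)"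

definition rule_valid :: "'d model \<Rightarrow> 'd \<Rightarrow> 'd \<Rightarrow> bool" where
  "rule_valid M \<rho> r \<longleftrightarrow>
     (\<forall>H m. (\<forall>A\<in>set H. true_stmt M A) \<and> m > 0 \<longrightarrow>
        (\<forall>A\<in>set (rule_output M r H \<rho> m). true_stmt M A))"

definition library_valid :: "'d model \<Rightarrow> 'd \<Rightarrow> bool" where
  "library_valid M \<rho> \<longleftrightarrow> (\<forall>r\<in>seq_terms M \<rho>. rule_valid M \<rho> r)"


definition is_base :: "'d model \<Rightarrow> 'd set \<Rightarrow> bool" where
  "is_base M \<B> \<longleftrightarrow> (\<forall>r\<in>\<B>. is_rule M r) \<and>
     (finite \<B> \<or> (\<exists>\<sigma>. is_library M \<sigma> \<and> \<B> = seq_terms M \<sigma>))"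

definition base_library :: "'d model \<Rightarrow> 'd set \<Rightarrow> 'd \<Rightarrow> bool" where
  "base_library M \<B> \<rho> \<longleftrightarrow> is_library M \<rho> \<and> \<B> \<subseteq> seq_terms M \<rho>"

definition valid_outside :: "'d model \<Rightarrow> 'd set \<Rightarrow> 'd \<Rightarrow> bool" where
  "valid_outside M \<B> \<rho> \<longleftrightarrow> (\<forall>r \<in> seq_terms M \<rho> - \<B>. rule_valid M \<rho> r)"

definition stable_base :: "'d model \<Rightarrow> 'd set \<Rightarrow> bool" where
  "stable_base M \<B> \<longleftrightarrow> is_base M \<B> \<and>
     (\<forall>\<rho>. base_library M \<B> \<rho> \<and> valid_outside M \<B> \<rho> \<longrightarrow> library_valid M \<rho>)"


text \<open>The successive lists \<open>H\<^sub>0, H\<^sub>1, \<dots>\<close> computed by the algorithm \<open>deduce\<close>.\<close>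

primrec deduce_list :: "'d model \<Rightarrow> 'd list \<Rightarrow> 'd \<Rightarrow> nat \<Rightarrow> 'd list" where
  "deduce_list M \<Gamma> \<rho> 0 = \<Gamma>"
| "deduce_list M \<Gamma> \<rho> (Suc i) =
     (case sched M (Suc i) of (k, m) \<Rightarrow>
        rule_output M (seq_term M \<rho> k) (deduce_list M \<Gamma> \<rho> i) \<rho> m)"

definition turnstile :: "'d model \<Rightarrow> 'd list \<Rightarrow> 'd \<Rightarrow> 'd \<Rightarrow> 'd" where
  "turnstile M \<Gamma> \<rho> B = lst M [deduce_alg M, lst M [lst M \<Gamma>, \<rho>, B], num M 1]"

definition imp_stmt :: "'d model \<Rightarrow> 'd \<Rightarrow> 'd \<Rightarrow> 'd \<Rightarrow> 'd" where
  "imp_stmt M \<rho> A B = turnstile M [A] \<rho> B"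

definition neg_stmt :: "'d model \<Rightarrow> 'd \<Rightarrow> 'd \<Rightarrow> 'd" where
  "neg_stmt M \<rho> A = imp_stmt M \<rho> A (falsum M)"

definition conj_stmt :: "'d model \<Rightarrow> 'd \<Rightarrow> 'd \<Rightarrow> 'd" where
  "conj_stmt M A B = lst M [and_alg M, lst M [A, B], num M 1]"

definition disj_stmt :: "'d model \<Rightarrow> 'd \<Rightarrow> 'd \<Rightarrow> 'd" where
  "disj_stmt M A B = lst M [or_alg M, lst M [A, B], num M 1]"


text \<open>The algorithms \<open>and\<close>, \<open>or\<close> and \<open>deduce\<close> are constrained only on the inputs for which they are
  specified; they may behave arbitrarily elsewhere.\<close>

locale framework =
  fixes M :: "'d model"
  assumes inj_num: "inj (num M)"
    and inj_lst: "inj (lst M)"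
    and size_pos: "\<And>u. dsize M u > 0"
    and finite_size: "\<And>n. finite {u. dsize M u = n}"
    and size_lst: "\<And>us. (\<Sum>u\<leftarrow>us. dsize M u) < dsize M (lst M us)"
    and runtime_pos: "\<And>a u. halts M a u \<Longrightarrow> runtime M a u > 0"
    and runtime_subprocs: "\<And>a u. halts M a u \<Longrightarrow>
      (\<Sum>(b, w) \<in># filter_mset (\<lambda>(b, w). halts M b w) (subprocs M a u). runtime M b w)
        < runtime M a u"
    and recursive: "recursive_model M"
    and identity_alg: "identity_alg M \<in> algs M"
      "\<And>u. run M (identity_alg M) u = Some u"
    and and_alg: "and_alg M \<in> algs M"
      "\<And>A B. stmt M A \<Longrightarrow> stmt M B \<Longrightarrow> run M (and_alg M) (lst M [A, B]) =
         (if true_stmt M A \<and> true_stmt M B then Some (num M 1)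
          else if directly_false M A \<or> directly_false M B then Some (num M 0) else None)"
    and or_alg: "or_alg M \<in> algs M"
      "\<And>A B. stmt M A \<Longrightarrow> stmt M B \<Longrightarrow> run M (or_alg M) (lst M [A, B]) =
         (if true_stmt M A \<or> true_stmt M B then Some (num M 1)
          else if directly_false M A \<and> directly_false M B then Some (num M 0) else None)"
    and sched_bij: "bij_betw (sched M) {1..} ({1..} \<times> {1..})"
    and sched_recursive: "\<exists>p q. \<forall>i\<ge>1.
      rec_eval p [i] (fst (sched M i)) \<and> rec_eval q [i] (snd (sched M i))"
    and deduce_alg: "deduce_alg M \<in> algs M"
      "\<And>\<Gamma> \<rho> B. \<forall>A\<in>set \<Gamma>. stmt M A \<Longrightarrow> is_library M \<rho> \<Longrightarrow> stmt M B \<Longrightarrow>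
         run M (deduce_alg M) (lst M [lst M \<Gamma>, \<rho>, B]) =
         (if \<exists>i>0. B \<in> set (deduce_list M \<Gamma> \<rho> i) then Some (num M 1) else None)"


text \<open>A rule diagram is given by its instances \<open>(premises, conclusion)\<close> for each nominal library.
  The order in which the conclusions are appended is left open.\<close>

definition implements :: "'d model \<Rightarrow> 'd \<Rightarrow> ('d \<Rightarrow> ('d list \<times> 'd) set) \<Rightarrow> bool" where
  "implements M P D \<longleftrightarrow> P \<in> algs M \<and>
     (\<forall>H \<rho> m. (\<forall>A\<in>set H. stmt M A) \<and> alg_seq M \<rho> \<and> m > 0 \<longrightarrow>
        (\<exists>C. run M P (rule_input M H \<rho> m) = Some (lst M (H @ C)) \<and>
             set C = {Y. \<exists>Xs. (Xs, Y) \<in> D \<rho> \<and> set Xs \<subseteq> set H}))"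

definition diagram_P11 :: "'d model \<Rightarrow> 'd \<Rightarrow> ('d list \<times> 'd) set" where
  "diagram_P11 M \<rho> =
     {([neg_stmt M \<rho> (conj_stmt M A B)], disj_stmt M (neg_stmt M \<rho> A) (neg_stmt M \<rho> B)) | A B. stmt M A \<and> stmt M B}"

end

theory Submission
  imports Defs
begin

text \<open>Let \<open>A\<close> and \<open>B\<close> be the statements that the algorithm \<open>a\<close>, run on its own code, outputs 0
  respectively 1. They exclude each other, so the rule deriving \<open>\<F>\<close> from \<open>A \<and> B\<close> (for all \<open>a\<close>) is valid;
  added to a stable base it gives a valid library \<open>\<rho>\<close> with \<open>\<not>\<^sub>\<rho>(A \<and> B)\<close> true. By the law, \<open>A\<close> or \<open>B\<close> is
  refutable in \<open>\<rho>\<close> for every \<open>a\<close>. The algorithm that searches for the first refutation and outputs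
  0 if it refutes \<open>A\<close> and 1 if it refutes \<open>B\<close> makes, on its own code, the refuted statement true,
  against the validity of \<open>\<rho>\<close>.\<close>

section \<open>Computable functions\<close>

text \<open>An element of \<open>D\<close> is presented to the machine as the tuple \<open>env e\<close>. Keeping the tuple apart from
  \<open>e\<close> lets functions of data and lists be composed without mentioning their decoding.\<close>

definition computable_on :: "('e \<Rightarrow> nat list) \<Rightarrow> 'e set \<Rightarrow> ('e \<Rightarrow> nat) \<Rightarrow> bool" where
  "computable_on env D f \<longleftrightarrow> (\<exists>p. \<forall>e\<in>D. rec_eval p (env e) (f e))"

lemma computable_on_cong:
  assumes "computable_on env D f" "\<And>e. e \<in> D \<Longrightarrow> f e = g e"
  shows "computable_on env D g"
  using assms unfolding computable_on_def by fastforce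

text \<open>The machine for \<open>g\<close> only sees the tuple \<open>env' (h e)\<close>, so it
  suffices to compute the components \<open>ks\<close> of that tuple. The value \<open>h e\<close>
  itself may have any type.\<close>

lemma computable_compose:
  assumes g: "computable_on env' D' g"
    and h: "\<And>e. e \<in> D \<Longrightarrow> h e \<in> D'" "\<And>e. e \<in> D \<Longrightarrow> env' (h e) = map (\<lambda>k. k e) ks"
    and ks: "\<And>k. k \<in> set ks \<Longrightarrow> computable_on env D k"
  shows "computable_on env D (\<lambda>e. g (h e))"
proof -
  obtain p where p: "\<And>e. e \<in> D' \<Longrightarrow> rec_eval p (env' e) (g e)"
    using g unfolding computable_on_def by blast
  have "\<forall>k\<in>set ks. \<exists>q. \<forall>e\<in>D. rec_eval q (env e) (k e)"
    using ks unfolding computable_on_def by blast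
  then obtain Q where Q: "\<And>k e. k \<in> set ks \<Longrightarrow> e \<in> D \<Longrightarrow> rec_eval (Q k) (env e) (k e)"
    by (metis (no_types))
  have "rec_eval (Comp p (map Q ks)) (env e) (g (h e))" if "e \<in> D" for e
  proof (rule rec_eval.Comp)
    show "length (env' (h e)) = length (map Q ks)"
      using h(2)[OF that] by simp
    show "\<forall>i<length (map Q ks). rec_eval (map Q ks ! i) (env e) (env' (h e) ! i)"
      using h(2)[OF that] Q that by simp
    show "rec_eval p (env' (h e)) (g (h e))"
      using p h(1) that by blast
  qed
  then show ?thesis unfolding computable_on_def by blast
qed

lemma computable_compose1:
  assumes "computable_on (\<lambda>a. [s a]) D' g" "computable_on env D (\<lambda>e. s (h e))"
    and "\<And>e. e \<in> D \<Longrightarrow> h e \<in> D'"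
  shows "computable_on env D (\<lambda>e. g (h e))"
  by (rule computable_compose[OF assms(1), where ks = "[\<lambda>e. s (h e)]"]) (use assms in auto)

lemma computable_compose2:
  assumes "computable_on (\<lambda>(a, b). [s a, t b]) D' (\<lambda>(a, b). g a b)"
    and "computable_on env D (\<lambda>e. s (h e))" "computable_on env D (\<lambda>e. t (k e))"
    and "\<And>e. e \<in> D \<Longrightarrow> (h e, k e) \<in> D'"
  shows "computable_on env D (\<lambda>e. g (h e) (k e))"
  using computable_compose[OF assms(1), where ks = "[\<lambda>e. s (h e), \<lambda>e. t (k e)]"
    and h = "\<lambda>e. (h e, k e)" and D = D and env = env] assms(2-4) by auto

lemma computable_proj:
  assumes "\<And>e. e \<in> D \<Longrightarrow> i < length (env e) \<and> env e ! i = f e"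
  shows "computable_on env D f"
  unfolding computable_on_def using assms rec_eval.Proj by metis

lemma computable_Suc:
  assumes "computable_on env D f"
  shows "computable_on env D (\<lambda>e. Suc (f e))"
proof -
  have "computable_on (\<lambda>n. [n]) UNIV Suc"
    unfolding computable_on_def using rec_eval.Succ by blast
  then show ?thesis by (rule computable_compose1[where s = "\<lambda>n. n"]) (use assms in auto)
qed

lemma computable_const: "computable_on env D (\<lambda>e. c)"
proof (induction c)
  case 0
  then show ?case unfolding computable_on_def using rec_eval.Zero by blast
next
  case (Suc c)
  then show ?case by (rule computable_Suc)
qed

text \<open>The recursion step may use the previous value, so the latter is put into the environment.\<close>

lemma computable_primrec:
  assumes 0: "computable_on env D (f 0)"
    and Suc: "computable_on (\<lambda>(n, e). n # f n e # env e) (UNIV \<times> D) (\<lambda>(n, e). f (Suc n) e)"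
  shows "computable_on (\<lambda>(n, e). n # env e) (UNIV \<times> D) (\<lambda>(n, e). f n e)"
proof -
  obtain p where p: "\<And>e. e \<in> D \<Longrightarrow> rec_eval p (env e) (f 0 e)"
    using 0 unfolding computable_on_def by blast
  obtain q where q: "\<And>n e. e \<in> D \<Longrightarrow> rec_eval q (n # f n e # env e) (f (Suc n) e)"
    using Suc unfolding computable_on_def by force
  have "rec_eval (PrimRec p q) (n # env e) (f n e)" if "e \<in> D" for n e
    by (induction n) (use p q that in \<open>auto intro: rec_eval.PrimRec_0 rec_eval.PrimRec_Suc\<close>)
  then show ?thesis unfolding computable_on_def by auto
qed

section \<open>Arithmetic, case distinction and decidable predicates\<close>

lemma computable_pred:
  assumes "computable_on env D f"
  shows "computable_on env D (\<lambda>e. f e - 1)"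
proof -
  \<comment> \<open>A dummy parameter of type \<open>unit\<close> with the empty tuple fits this
    parameterless recursion into \<open>computable_primrec\<close>.\<close>
  have "computable_on (\<lambda>(n, e). n # []) (UNIV \<times> UNIV) (\<lambda>(n, e :: unit). n - 1)"
    by (rule computable_primrec) (auto intro: computable_const computable_proj[where i = 0])
  from computable_compose[OF this, where ks = "[f]" and h = "\<lambda>e. (f e, ())"]
  show ?thesis using assms by force
qed

lemma computable_minus:
  assumes "computable_on env D f" "computable_on env D g"
  shows "computable_on env D (\<lambda>e. f e - g e)"
proof -
  \<comment> \<open>The recursion runs on the subtrahend, because \<open>a - Suc n\<close> is the
    predecessor of the previous value; hence the swapped arguments.\<close>
  have "computable_on (\<lambda>(n, a). [n, a]) (UNIV \<times> UNIV) (\<lambda>(n, a). a - n)"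
  proof (rule computable_primrec)
    show "computable_on (\<lambda>a. [a]) UNIV (\<lambda>a. a - 0)"
      by (rule computable_proj[where i = 0]) simp
    have "computable_on (\<lambda>(n, a). [n, a - n, a]) (UNIV \<times> UNIV) (\<lambda>e. (case e of (n, a) \<Rightarrow> a - n) - 1)"
      by (rule computable_pred[OF computable_proj[where i = 1]]) auto
    then show "computable_on (\<lambda>(n, a). [n, a - n, a]) (UNIV \<times> UNIV) (\<lambda>(n, a). a - Suc n)"
      by (rule computable_on_cong) auto
  qed
  from computable_compose2[where s = "\<lambda>n. n" and t = "\<lambda>n. n", OF this assms(2) assms(1)]
  show ?thesis by simp
qed

lemma computable_if_nat:
  assumes "computable_on env D c" "computable_on env D f" "computable_on env D g"
  shows "computable_on env D (\<lambda>e. if c e = 0 then g e else f e)"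
proof -
  \<comment> \<open>Case distinction is a primitive recursion on the condition whose step discards
    the previous value. Both branches get evaluated, so both have to be defined on all of
    \<open>D\<close>.\<close>
  have "computable_on (\<lambda>(n, ab). n # (case ab of (a, b) \<Rightarrow> [a, b])) (UNIV \<times> UNIV)
      (\<lambda>(n, ab). if n = 0 then snd ab else fst ab)"
    by (rule computable_primrec[where f = "\<lambda>n ab. if n = 0 then snd ab else fst ab"])
      (auto intro: computable_proj[where i = 1] computable_proj[where i = 2])
  from computable_compose[OF this, where ks = "[c, f, g]" and h = "\<lambda>e. (c e, f e, g e)"
      and D = D and env = env]
  show ?thesis using assms by (auto cong: if_cong)
qed

abbreviation decidable_on :: "('e \<Rightarrow> nat list) \<Rightarrow> 'e set \<Rightarrow> ('e \<Rightarrow> bool) \<Rightarrow> bool" where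
  "decidable_on env D P \<equiv> computable_on env D (\<lambda>e. of_bool (P e))"

lemma computable_if:
  assumes "decidable_on env D P" "computable_on env D f" "computable_on env D g"
  shows "computable_on env D (\<lambda>e. if P e then f e else g e)"
  using computable_if_nat[OF assms] by (rule computable_on_cong) auto

lemma decidable_not:
  assumes "decidable_on env D P"
  shows "decidable_on env D (\<lambda>e. \<not> P e)"
  using computable_if[OF assms computable_const[of _ _ 0] computable_const[of _ _ 1]]
  by (rule computable_on_cong) auto

lemma decidable_conj:
  assumes "decidable_on env D P" "decidable_on env D Q"
  shows "decidable_on env D (\<lambda>e. P e \<and> Q e)"
  using computable_if[OF assms(1) assms(2) computable_const[of _ _ 0]]
  by (rule computable_on_cong) auto

lemma decidable_disj:
  assumes "decidable_on env D P" "decidable_on env D Q"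
  shows "decidable_on env D (\<lambda>e. P e \<or> Q e)"
  using computable_if[OF assms(1) computable_const[of _ _ 1] assms(2)]
  by (rule computable_on_cong) auto

text \<open>Two numbers are equal exactly if both truncated differences vanish.\<close>

lemma decidable_eq:
  assumes "computable_on env D f" "computable_on env D g"
  shows "decidable_on env D (\<lambda>e. f e = g e)"
proof -
  have "computable_on env D (\<lambda>e. if f e - g e = 0 then
      (if g e - f e = 0 then 1 else 0) else 0)"
    by (intro computable_if_nat computable_minus computable_const assms)
  then show ?thesis by (rule computable_on_cong) auto
qed

section \<open>Unbounded and bounded search\<close>

lemma computable_Least:
  assumes P: "decidable_on (\<lambda>(n, e). n # env e) (UNIV \<times> D) (\<lambda>(n, e). P n e)"
    and ex: "\<And>e. e \<in> D \<Longrightarrow> \<exists>n. P n e"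
  shows "computable_on env D (\<lambda>e. LEAST n. P n e)"
proof -
  \<comment> \<open>\<open>Mu\<close> looks for a zero, while \<open>of_bool\<close> encodes truth
    by 1; the predicate is therefore negated.\<close>
  have "computable_on (\<lambda>(n, e). n # env e) (UNIV \<times> D) (\<lambda>(n, e). of_bool (\<not> P n e))"
    using decidable_not[OF P] by (rule computable_on_cong) auto
  then obtain p where p: "\<And>n e. e \<in> D \<Longrightarrow> rec_eval p (n # env e) (of_bool (\<not> P n e))"
    unfolding computable_on_def by force
  have "rec_eval (Mu p) (env e) (LEAST n. P n e)" if "e \<in> D" for e
  proof (rule rec_eval.Mu)
    have "P (LEAST n. P n e) e" using ex[OF that] by (rule LeastI_ex)
    then show "rec_eval p ((LEAST n. P n e) # env e) 0"
      using p[OF that, of "LEAST n. P n e"] by simp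
    show "\<forall>i<LEAST n. P n e. \<exists>y. rec_eval p (i # env e) (Suc y)"
    proof (intro allI impI)
      fix i assume "i < (LEAST n. P n e)"
      then have "\<not> P i e" by (rule not_less_Least)
      then show "\<exists>y. rec_eval p (i # env e) (Suc y)"
        using p[OF that, of i] by auto
    qed
  qed
  then show ?thesis unfolding computable_on_def by blast
qed

text \<open>The search for the least \<open>c\<close> that is the bound or satisfies
  \<open>P\<close> always stops, and its result differs from the bound exactly if there is a witness
  below it. The search evaluates the bound in the environment extended by \<open>c\<close>, hence
  \<open>m'\<close>.\<close>

lemma decidable_ex_less:
  assumes m: "computable_on env D m"
    and m': "computable_on (\<lambda>(c, e). c # env e) (UNIV \<times> D) (\<lambda>(c, e). m e)"
    and P: "decidable_on (\<lambda>(c, e). c # env e) (UNIV \<times> D) (\<lambda>(c, e). P c e)"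
  shows "decidable_on env D (\<lambda>e. \<exists>c<m e. P c e)"
proof -
  let ?n = "\<lambda>e. LEAST c. c = m e \<or> P c e"
  have "computable_on (\<lambda>(c, e). c # env e) (UNIV \<times> D) fst"
    by (rule computable_proj[where i = 0]) auto
  from decidable_disj[OF decidable_eq[OF this m'] P]
  have "decidable_on (\<lambda>(c, e). c # env e) (UNIV \<times> D) (\<lambda>(c, e). c = m e \<or> P c e)"
    by (rule computable_on_cong) auto
  then have "computable_on env D ?n" by (rule computable_Least) blast
  from decidable_not[OF decidable_eq[OF this m]]
  have "decidable_on env D (\<lambda>e. ?n e \<noteq> m e)" .
  moreover have "?n e \<noteq> m e \<longleftrightarrow> (\<exists>c<m e. P c e)" for e
  proof
    have n: "?n e = m e \<or> P (?n e) e" by (rule LeastI[of _ "m e"]) simp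
    have "?n e \<le> m e" by (rule Least_le) simp
    then show "\<exists>c<m e. P c e" if "?n e \<noteq> m e" using n that by (metis le_neq_implies_less)
    assume "\<exists>c<m e. P c e"
    then obtain c where c: "c < m e" "P c e" by blast
    then have "?n e \<le> c" by (intro Least_le) blast
    then show "?n e \<noteq> m e" using c by simp
  qed
  ultimately show ?thesis by simp
qed

section \<open>Goedel numbers of data\<close>

text \<open>A single coding that witnesses \<open>recursive_model\<close> is fixed, so that all
  computability facts refer to the same numbers.\<close>

locale coded_framework = framework M for M :: "'d model" +
  fixes code :: "'d \<Rightarrow> nat"
  assumes bij_code: "bij code"
    and num_rec: "recursive_fun (\<lambda>n. code (num M n))"
    and cons_rec: "\<exists>p. \<forall>x xs. rec_eval p [code x, code (lst M xs)] (code (lst M (x # xs)))"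
    and lst_rec: "recursive_set (code ` range (lst M))"
    and algs_rec: "recursive_set (code ` algs M)"
    and universal: "\<exists>p. \<forall>a\<in>algs M. \<forall>u v. run M a u = Some v \<longleftrightarrow>
      rec_eval p [code a, code u] (code v)"
    and all_recursive: "\<forall>p. \<exists>a\<in>algs M. \<forall>u v. run M a u = Some v \<longleftrightarrow>
      rec_eval p [code u] (code v)"
begin

abbreviation lcode :: "'d list \<Rightarrow> nat" where
  "lcode xs \<equiv> code (lst M xs)"

abbreviation decode :: "nat \<Rightarrow> 'd" where
  "decode \<equiv> inv code"

lemma code_eq_iff [simp]: "code x = code y \<longleftrightarrow> x = y"
  using bij_code by (meson bij_is_inj injD)

lemma lst_eq_iff [simp]: "lst M xs = lst M ys \<longleftrightarrow> xs = ys"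
  using inj_lst by (meson injD)

lemma num_eq_iff [simp]: "num M m = num M n \<longleftrightarrow> m = n"
  using inj_num by (meson injD)

lemma decode_code [simp]: "decode (code x) = x"
  using bij_code by (meson bij_is_inj inv_f_f)

lemma code_decode [simp]: "code (decode n) = n"
  using bij_code by (meson bij_is_surj surj_f_inv_f)

lemma computable_num:
  assumes "computable_on env D f"
  shows "computable_on env D (\<lambda>e. code (num M (f e)))"
proof -
  have "computable_on (\<lambda>n. [n]) UNIV (\<lambda>n. code (num M n))"
    using num_rec unfolding recursive_fun_def computable_on_def by simp
  then show ?thesis by (rule computable_compose1[where s = "\<lambda>n. n"]) (use assms in auto)
qed

lemma computable_cons:
  assumes "computable_on env D (\<lambda>e. code (x e))" "computable_on env D (\<lambda>e. lcode (xs e))"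
  shows "computable_on env D (\<lambda>e. lcode (x e # xs e))"
proof -
  have "computable_on (\<lambda>(x, xs). [code x, lcode xs]) UNIV (\<lambda>(x, xs). lcode (x # xs))"
    using cons_rec unfolding computable_on_def by auto
  from computable_compose2[OF this assms] show ?thesis by simp
qed

lemma decidable_recursive_set:
  assumes "recursive_set S" "computable_on env D f"
  shows "decidable_on env D (\<lambda>e. f e \<in> S)"
proof -
  have "computable_on (\<lambda>n. [n]) UNIV (\<lambda>n. of_bool (n \<in> S))"
    using assms(1) unfolding recursive_set_def recursive_fun_def computable_on_def of_bool_def
    by simp
  then show ?thesis by (rule computable_compose1[where s = "\<lambda>n. n"]) (use assms in auto)
qed

text \<open>The universal function allows the algorithm \<open>a e\<close> to vary with
  \<open>e\<close>. Only halting processes are run, since \<open>computable_on\<close> requires a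
  value on all of \<open>D\<close>.\<close>

lemma computable_run:
  assumes "computable_on env D (\<lambda>e. code (a e))" "computable_on env D (\<lambda>e. code (u e))"
    and "\<And>e. e \<in> D \<Longrightarrow> a e \<in> algs M \<and> run M (a e) (u e) = Some (v e)"
  shows "computable_on env D (\<lambda>e. code (v e))"
proof -
  have "computable_on (\<lambda>(a, u). [code a, code u]) {(a, u). a \<in> algs M \<and> run M a u \<noteq> None}
      (\<lambda>(a, u). code (the (run M a u)))"
    using universal unfolding computable_on_def by fastforce
  then have "computable_on env D (\<lambda>e. code (the (run M (a e) (u e))))"
    by (rule computable_compose2) (use assms in auto)
  then show ?thesis by (rule computable_on_cong) (use assms(3) in auto)
qed

text \<open>The way back from recursive functions to algorithms of the model. Nothing is claimed
  about inputs other than \<open>u e\<close> for \<open>e\<close> in \<open>D\<close>.\<close>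

lemma algorithm_exists:
  assumes "computable_on (\<lambda>e. [code (u e)]) D (\<lambda>e. code (v e))"
  shows "\<exists>a\<in>algs M. \<forall>e\<in>D. run M a (u e) = Some (v e)"
  using assms all_recursive unfolding computable_on_def by metis

text \<open>The number is recovered by searching for one whose numeral has the given code;
  injectivity of \<open>num M\<close> makes the search return the right one.\<close>

lemma computable_unnum:
  assumes "computable_on env D (\<lambda>e. code (num M (f e)))"
  shows "computable_on env D f"
proof -
  have "computable_on (\<lambda>n. [code (num M n)]) UNIV (\<lambda>n. LEAST k. code (num M k) = code (num M n))"
  proof (rule computable_Least)
    have "decidable_on (\<lambda>(k, n). [k, code (num M n)]) (UNIV \<times> UNIV)
        (\<lambda>e. code (num M (fst e)) = code (num M (snd e)))"
      by (intro decidable_eq computable_num[where f = fst] computable_proj[where i = 0]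
          computable_proj[where i = 1]) auto
    then show "decidable_on (\<lambda>(k, n). [k, code (num M n)]) (UNIV \<times> UNIV)
        (\<lambda>(k, n). code (num M k) = code (num M n))"
      by (rule computable_on_cong) auto
  qed auto
  then have "computable_on (\<lambda>n. [code (num M n)]) UNIV (\<lambda>n. n)"
    by (rule computable_on_cong) (auto intro: Least_equality)
  from computable_compose1[OF this assms] show ?thesis by simp
qed

text \<open>The schedule of \<open>deduce\<close> serves as a pairing function: it turns the search for the head and
  the tail of a coded list into a search over a single number.\<close>

lemma computable_sched:
  assumes "computable_on env D f" "\<And>e. e \<in> D \<Longrightarrow> f e \<ge> 1"
  shows "computable_on env D (\<lambda>e. fst (sched M (f e)))"
    and "computable_on env D (\<lambda>e. snd (sched M (f e)))"
proof -
  obtain p q where pq: "\<And>i. i \<ge> 1 \<Longrightarrow> rec_eval p [i] (fst (sched M i)) \<and>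
      rec_eval q [i] (snd (sched M i))"
    using sched_recursive by blast
  have 1: "computable_on (\<lambda>i. [i]) {1..} (\<lambda>i. fst (sched M i))"
    unfolding computable_on_def using pq by auto
  have 2: "computable_on (\<lambda>i. [i]) {1..} (\<lambda>i. snd (sched M i))"
    unfolding computable_on_def using pq by auto
  show "computable_on env D (\<lambda>e. fst (sched M (f e)))"
    by (rule computable_compose1[OF 1, where h = f]) (use assms in auto)
  show "computable_on env D (\<lambda>e. snd (sched M (f e)))"
    by (rule computable_compose1[OF 2, where h = f]) (use assms in auto)
qed

lemma sched_pos:
  assumes "i \<ge> 1"
  shows "fst (sched M i) \<ge> 1" "snd (sched M i) \<ge> 1"
proof -
  have "sched M i \<in> {1..} \<times> {1..}" using bij_betwE[OF sched_bij] assms by simp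
  then show "fst (sched M i) \<ge> 1" "snd (sched M i) \<ge> 1" by (simp_all add: mem_Times_iff)
qed

text \<open>Ensures that \<open>deduce\<close> eventually applies every rule with every resource
  integer. The index is shifted to match the recursion of \<open>deduce_list\<close>.\<close>

lemma sched_surj:
  assumes "k \<ge> 1" "m \<ge> 1"
  obtains i where "sched M (Suc i) = (k, m)"
proof -
  have "(k, m) \<in> sched M ` {1..}"
    using sched_bij assms unfolding bij_betw_def by auto
  then obtain j where "j \<ge> 1" "sched M j = (k, m)" by auto
  then show ?thesis using that[of "j - 1"] by simp
qed

text \<open>The shifts by one adapt the schedule, which lives on positive numbers, to codes, which
  may be 0.\<close>

definition split_hd :: "nat \<Rightarrow> nat" where
  "split_hd i = fst (sched M (Suc i)) - 1"

definition split_tl :: "nat \<Rightarrow> nat" where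
  "split_tl i = snd (sched M (Suc i)) - 1"

lemma split_surj:
  obtains i where "split_hd i = a" "split_tl i = b"
proof -
  obtain i where "sched M (Suc i) = (Suc a, Suc b)"
    by (rule sched_surj[of "Suc a" "Suc b"]) simp_all
  then show ?thesis using that[of i] unfolding split_hd_def split_tl_def by simp
qed

lemma computable_split:
  assumes "computable_on env D f"
  shows "computable_on env D (\<lambda>e. split_hd (f e))" "computable_on env D (\<lambda>e. split_tl (f e))"
  unfolding split_hd_def split_tl_def
  by (rule computable_pred, rule computable_sched, rule computable_Suc[OF assms], simp)+

section \<open>Decoding lists\<close>

definition is_lcode :: "nat \<Rightarrow> bool" where
  "is_lcode n \<longleftrightarrow> n \<in> code ` range (lst M)"

text \<open>Not every number codes a list; the default \<open>[]\<close> keeps decoding total and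
  computable.\<close>

definition unlst :: "nat \<Rightarrow> 'd list" where
  "unlst n = (if is_lcode n then inv (lst M) (decode n) else [])"

lemma lcode_unlst: "lcode (unlst n) = (if is_lcode n then n else lcode [])"
  unfolding unlst_def is_lcode_def by (auto simp: f_inv_into_f)

lemma is_lcode_lcode [simp]: "is_lcode (lcode xs)"
  unfolding is_lcode_def by blast

lemma unlst_lcode [simp]: "unlst (lcode xs) = xs"
  using lcode_unlst[of "lcode xs"] by simp

text \<open>The case of the empty list makes the search for \<open>i\<close> stop on every
  list.\<close>

definition splits :: "'d list \<Rightarrow> nat \<Rightarrow> bool" where
  "splits xs i \<longleftrightarrow> xs = [] \<or>
     is_lcode (split_tl i) \<and> xs = decode (split_hd i) # unlst (split_tl i)"

definition split_index :: "'d list \<Rightarrow> nat" where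
  "split_index xs = (LEAST i. splits xs i)"

lemma splits_split_index: "splits xs (split_index xs)"
proof -
  have "\<exists>i. splits xs i"
  proof (cases xs)
    case (Cons x ys)
    obtain i where "split_hd i = code x" "split_tl i = lcode ys" by (rule split_surj)
    then have "splits xs i" using Cons unfolding splits_def by simp
    then show ?thesis by blast
  qed (simp add: splits_def)
  then show ?thesis unfolding split_index_def by (rule LeastI_ex)
qed

lemma computable_split_index:
  assumes "computable_on env D (\<lambda>e. lcode (xs e))"
  shows "computable_on env D (\<lambda>e. split_index (xs e))"
proof -
  let ?env = "\<lambda>(i, xs). [i, lcode xs]"
  have i: "computable_on ?env (UNIV \<times> UNIV) fst"
    by (rule computable_proj[where i = 0]) auto
  have xs: "computable_on ?env (UNIV \<times> UNIV) (\<lambda>e. lcode (snd e))"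
    by (rule computable_proj[where i = 1]) auto
  have hd: "computable_on ?env (UNIV \<times> UNIV) (\<lambda>e. code (decode (split_hd (fst e))))"
    using computable_split(1)[OF i] by simp
  have is_l: "decidable_on ?env (UNIV \<times> UNIV) (\<lambda>e. is_lcode (split_tl (fst e)))"
    unfolding is_lcode_def by (intro decidable_recursive_set lst_rec computable_split i)
  have tl: "computable_on ?env (UNIV \<times> UNIV) (\<lambda>e. lcode (unlst (split_tl (fst e))))"
    unfolding lcode_unlst
    by (intro computable_if is_l computable_split i computable_const)
  \<comment> \<open>The equations in \<open>splits\<close> are restated between codes, where
    equality is decidable.\<close>
  have "decidable_on ?env (UNIV \<times> UNIV) (\<lambda>e. lcode (snd e) = lcode [] \<or> is_lcode (split_tl (fst e))
      \<and> lcode (snd e) = lcode (decode (split_hd (fst e)) # unlst (split_tl (fst e))))"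
    by (intro decidable_disj decidable_conj decidable_eq xs computable_const is_l computable_cons
        hd tl)
  then have "decidable_on ?env (UNIV \<times> UNIV) (\<lambda>(i, xs). splits xs i)"
    by (rule computable_on_cong) (auto simp: splits_def)
  then have "computable_on (\<lambda>xs. [lcode xs]) UNIV split_index"
    unfolding split_index_def
    by (rule computable_Least) (use splits_split_index in blast)
  from computable_compose1[OF this assms] show ?thesis by simp
qed

lemma decidable_Nil:
  assumes "computable_on env D (\<lambda>e. lcode (xs e))"
  shows "decidable_on env D (\<lambda>e. xs e = [])"
  using decidable_eq[OF assms computable_const[of _ _ "lcode []"]] by simp

lemma computable_hd:
  assumes "computable_on env D (\<lambda>e. lcode (xs e))"
  shows "computable_on env D (\<lambda>e. code (hd (xs e)))"
proof -
  \<comment> \<open>\<open>hd []\<close> is unspecified but fixed, so its code is a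
    constant.\<close>
  have "computable_on env D
      (\<lambda>e. if xs e = [] then code (hd []) else split_hd (split_index (xs e)))"
    by (intro computable_if decidable_Nil computable_const computable_split
        computable_split_index assms)
  then show ?thesis
  proof (rule computable_on_cong)
    fix e
    show "(if xs e = [] then code (hd []) else split_hd (split_index (xs e))) = code (hd (xs e))"
      using splits_split_index[of "xs e"] unfolding splits_def
      by (metis code_decode list.sel(1))
  qed
qed

lemma computable_tl:
  assumes "computable_on env D (\<lambda>e. lcode (xs e))"
  shows "computable_on env D (\<lambda>e. lcode (tl (xs e)))"
proof -
  have "computable_on env D
      (\<lambda>e. if xs e = [] then lcode [] else split_tl (split_index (xs e)))"
    by (intro computable_if decidable_Nil computable_const computable_split
        computable_split_index assms)
  then show ?thesis
  proof (rule computable_on_cong)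
    fix e
    show "(if xs e = [] then lcode [] else split_tl (split_index (xs e))) = lcode (tl (xs e))"
      using splits_split_index[of "xs e"] lcode_unlst[of "split_tl (split_index (xs e))"]
      unfolding splits_def by (metis list.sel(2,3))
  qed
qed

section \<open>Operations on coded lists\<close>

lemma computable_drop:
  assumes "computable_on env D n" "computable_on env D (\<lambda>e. lcode (xs e))"
  shows "computable_on env D (\<lambda>e. lcode (drop (n e) (xs e)))"
proof -
  have "computable_on (\<lambda>(n, xs). [n, lcode xs]) (UNIV \<times> UNIV) (\<lambda>(n, xs). lcode (drop n xs))"
  proof (rule computable_primrec)
    show "computable_on (\<lambda>xs. [lcode xs]) UNIV (\<lambda>xs. lcode (drop 0 xs))"
      by (rule computable_proj[where i = 0]) simp
    have "computable_on (\<lambda>(n, xs). [n, lcode (drop n xs), lcode xs]) (UNIV \<times> UNIV)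
        (\<lambda>e. lcode (tl (case e of (n, xs) \<Rightarrow> drop n xs)))"
      by (rule computable_tl, rule computable_proj[where i = 1]) auto
    then show "computable_on (\<lambda>(n, xs). [n, lcode (drop n xs), lcode xs]) (UNIV \<times> UNIV)
        (\<lambda>(n, xs). lcode (drop (Suc n) xs))"
      by (rule computable_on_cong) (auto simp: drop_Suc tl_drop)
  qed
  from computable_compose2[where s = "\<lambda>n. n", OF this assms] show ?thesis by simp
qed

lemma computable_length:
  assumes "computable_on env D (\<lambda>e. lcode (xs e))"
  shows "computable_on env D (\<lambda>e. length (xs e))"
proof -
  have "decidable_on (\<lambda>(i, xs). [i, lcode xs]) (UNIV \<times> UNIV) (\<lambda>e. drop (fst e) (snd e) = [])"
    by (intro decidable_Nil computable_drop computable_proj[where i = 0]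
        computable_proj[where i = 1]) auto
  then have "decidable_on (\<lambda>(i, xs). [i, lcode xs]) (UNIV \<times> UNIV) (\<lambda>(i, xs). drop i xs = [])"
    by (rule computable_on_cong) auto
  then have "computable_on (\<lambda>xs. [lcode xs]) UNIV (\<lambda>xs. LEAST i. drop i xs = [])"
    by (rule computable_Least) auto
  then have "computable_on (\<lambda>xs. [lcode xs]) UNIV length"
    by (rule computable_on_cong) (auto intro: Least_equality)
  from computable_compose1[OF this assms] show ?thesis by simp
qed

text \<open>Coded lists can only be extended at the front. Reversal gives access to the other end,
  where rules append their conclusions.\<close>

lemma computable_rev:
  assumes "computable_on env D (\<lambda>e. lcode (xs e))"
  shows "computable_on env D (\<lambda>e. lcode (rev (xs e)))"
proof -
  have 1: "computable_on (\<lambda>(n, xs). [n, lcode xs]) (UNIV \<times> UNIV)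
      (\<lambda>(n, xs). lcode (rev (take n xs)))"
  proof (rule computable_primrec)
    show "computable_on (\<lambda>xs. [lcode xs]) UNIV (\<lambda>xs. lcode (rev (take 0 xs)))"
      by (simp add: computable_const)
    let ?env = "\<lambda>(n, xs). [n, lcode (rev (take n xs)), lcode xs]"
    have drop: "computable_on ?env (UNIV \<times> UNIV) (\<lambda>e. lcode (drop (fst e) (snd e)))"
      by (intro computable_drop computable_proj[where i = 0] computable_proj[where i = 2]) auto
    have rec: "computable_on ?env (UNIV \<times> UNIV) (\<lambda>e. lcode (rev (take (fst e) (snd e))))"
      by (rule computable_proj[where i = 1]) auto
    \<comment> \<open>The case distinction is for steps past the end of the list, where
      \<open>take n xs\<close> no longer grows.\<close>
    have "computable_on ?env (UNIV \<times> UNIV) (\<lambda>e. if drop (fst e) (snd e) = []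
        then lcode (rev (take (fst e) (snd e)))
        else lcode (hd (drop (fst e) (snd e)) # rev (take (fst e) (snd e))))"
      by (intro computable_if decidable_Nil computable_cons computable_hd drop rec)
    then show "computable_on ?env (UNIV \<times> UNIV) (\<lambda>(n, xs). lcode (rev (take (Suc n) xs)))"
    proof (rule computable_on_cong)
      fix e :: "nat \<times> 'd list"
      obtain n xs where e: "e = (n, xs)" by force
      show "(if drop (fst e) (snd e) = [] then lcode (rev (take (fst e) (snd e)))
          else lcode (hd (drop (fst e) (snd e)) # rev (take (fst e) (snd e)))) =
          (case e of (n, xs) \<Rightarrow> lcode (rev (take (Suc n) xs)))"
      proof (cases "n < length xs")
        case True
        then show ?thesis unfolding e by (simp add: hd_drop_conv_nth take_Suc_conv_app_nth)
      qed (simp add: e)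
    qed
  qed
  from computable_compose2[where s = "\<lambda>n. n", OF this computable_length[OF assms] assms]
  show ?thesis by simp
qed

lemma decidable_member:
  assumes "computable_on env D (\<lambda>e. code (y e))" "computable_on env D (\<lambda>e. lcode (xs e))"
  shows "decidable_on env D (\<lambda>e. y e \<in> set (xs e))"
proof -
  \<comment> \<open>The scan stops at an occurrence of \<open>y\<close> or at the end of the list,
    so it always stops, and something is left of the list exactly if \<open>y\<close> was
    found.\<close>
  define P where "P i y xs \<longleftrightarrow> drop i xs = [] \<or> drop i xs = y # tl (drop i xs)"
    for i and y :: 'd and xs
  define pos where "pos y xs = (LEAST i. P i y xs)" for y xs
  have ex: "P (length xs) y xs" for y xs unfolding P_def by simp
  have pos_iff: "drop (pos y xs) xs \<noteq> [] \<longleftrightarrow> y \<in> set xs" for y xs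
  proof
    have P: "P (pos y xs) y xs" unfolding pos_def using ex by (rule LeastI)
    assume ne: "drop (pos y xs) xs \<noteq> []"
    then have "drop (pos y xs) xs = y # tl (drop (pos y xs) xs)" using P unfolding P_def by blast
    then have "y \<in> set (drop (pos y xs) xs)" by (metis list.set_intros(1))
    then show "y \<in> set xs" by (rule in_set_dropD)
  next
    assume "y \<in> set xs"
    then obtain j where j: "j < length xs" "xs ! j = y" unfolding in_set_conv_nth by blast
    then have "drop j xs = y # drop (Suc j) xs" using Cons_nth_drop_Suc by metis
    then have "P j y xs" unfolding P_def by (metis list.sel(3))
    then have "pos y xs \<le> j" unfolding pos_def by (rule Least_le)
    then show "drop (pos y xs) xs \<noteq> []" using j(1) by simp
  qed
  let ?env = "\<lambda>(i, e). i # (case e of (y, xs) \<Rightarrow> [code y, lcode xs])"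
  have drop: "computable_on ?env (UNIV \<times> UNIV) (\<lambda>e. lcode (drop (fst e) (snd (snd e))))"
    by (intro computable_drop computable_proj[where i = 0] computable_proj[where i = 2]) auto
  have y: "computable_on ?env (UNIV \<times> UNIV) (\<lambda>e. code (fst (snd e)))"
    by (rule computable_proj[where i = 1]) auto
  have "decidable_on ?env (UNIV \<times> UNIV) (\<lambda>e. drop (fst e) (snd (snd e)) = [] \<or>
      lcode (drop (fst e) (snd (snd e))) = lcode (fst (snd e) # tl (drop (fst e) (snd (snd e)))))"
    by (rule decidable_disj[OF decidable_Nil[OF drop]
          decidable_eq[OF drop computable_cons[OF y computable_tl[OF drop]]]])
  then have "decidable_on ?env (UNIV \<times> UNIV) (\<lambda>(i, e). P i (fst e) (snd e))"
    unfolding code_eq_iff lst_eq_iff P_def[symmetric] by (simp add: case_prod_unfold)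
  then have "computable_on (\<lambda>(y, xs). [code y, lcode xs]) UNIV (\<lambda>e. LEAST i. P i (fst e) (snd e))"
    by (rule computable_Least) (use ex in blast)
  then have "computable_on (\<lambda>(y, xs). [code y, lcode xs]) UNIV (\<lambda>(y, xs). pos y xs)"
    unfolding pos_def by (simp add: case_prod_unfold)
  from computable_compose2[OF this assms]
  have "computable_on env D (\<lambda>e. pos (y e) (xs e))" by simp
  then have "decidable_on env D (\<lambda>e. drop (pos (y e) (xs e)) (xs e) \<noteq> [])"
    by (intro decidable_not decidable_Nil computable_drop assms)
  then show ?thesis unfolding pos_iff .
qed

section \<open>Statements and deductions\<close>

lemma stmt_triple: "a \<in> algs M \<Longrightarrow> stmt M (lst M [a, u, v])"
  unfolding stmt_def by blast

lemma stmt_falsum: "stmt M (falsum M)"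
  unfolding falsum_def by (rule stmt_triple[OF identity_alg(1)])

lemma stmt_conj: "stmt M (conj_stmt M A B)"
  unfolding conj_stmt_def by (rule stmt_triple[OF and_alg(1)])

lemma stmt_disj: "stmt M (disj_stmt M A B)"
  unfolding disj_stmt_def by (rule stmt_triple[OF or_alg(1)])

lemma stmt_neg: "stmt M (neg_stmt M \<rho> A)"
  unfolding neg_stmt_def imp_stmt_def turnstile_def by (rule stmt_triple[OF deduce_alg(1)])

lemma true_triple: "true_stmt M (lst M [a, u, v]) \<longleftrightarrow> a \<in> algs M \<and> run M a u = Some v"
  unfolding true_stmt_def by auto

lemma falsum_not_true: "\<not> true_stmt M (falsum M)"
  unfolding falsum_def true_triple identity_alg(2) by simp

lemma true_conj:
  assumes "stmt M A" "stmt M B"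
  shows "true_stmt M (conj_stmt M A B) \<longleftrightarrow> true_stmt M A \<and> true_stmt M B"
  unfolding conj_stmt_def true_triple and_alg(2)[OF assms] using and_alg(1) by simp

lemma true_disj:
  assumes "stmt M A" "stmt M B"
  shows "true_stmt M (disj_stmt M A B) \<longleftrightarrow> true_stmt M A \<or> true_stmt M B"
  unfolding disj_stmt_def true_triple or_alg(2)[OF assms] using or_alg(1) by simp

lemma true_turnstile:
  assumes "\<forall>A\<in>set \<Gamma>. stmt M A" "is_library M \<rho>" "stmt M B"
  shows "true_stmt M (turnstile M \<Gamma> \<rho> B) \<longleftrightarrow> (\<exists>i>0. B \<in> set (deduce_list M \<Gamma> \<rho> i))"
  unfolding turnstile_def true_triple deduce_alg(2)[OF assms] using deduce_alg(1) by simp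

section \<open>Runs of rules and of \<open>deduce\<close>\<close>

lemma rule_output_eq:
  assumes "run M r (rule_input M H \<rho> m) = Some (lst M L)"
  shows "rule_output M r H \<rho> m = L"
  unfolding rule_output_def using assms by auto

lemma seq_term_rule:
  assumes "is_library M \<rho>" "n > 0"
  shows "is_rule M (seq_term M \<rho> n)" "run M \<rho> (num M n) = Some (seq_term M \<rho> n)"
proof -
  show "is_rule M (seq_term M \<rho> n)"
    using assms unfolding is_library_def seq_terms_def by blast
  show "run M \<rho> (num M n) = Some (seq_term M \<rho> n)"
    using assms unfolding is_library_def alg_seq_def halts_def seq_term_def by auto
qed

lemma rule_run:
  assumes "is_rule M r" "alg_seq M \<rho>" "\<forall>A\<in>set H. stmt M A" "m > 0"
  obtains C where "\<forall>A\<in>set C. stmt M A" "rule_output M r H \<rho> m = H @ C"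
    "run M r (rule_input M H \<rho> m) = Some (lst M (H @ C))"
proof -
  obtain C where C: "\<forall>A\<in>set C. stmt M A" "run M r (rule_input M H \<rho> m) = Some (lst M (H @ C))"
    using assms unfolding is_rule_def by blast
  then show ?thesis using that rule_output_eq[OF C(2)] by blast
qed

text \<open>Ties the definite description behind \<open>deduce_list\<close> to a halting run of the
  scheduled rule. The extension property serves inductions on the step, the run serves
  computability.\<close>

lemma rule_run_deduce_list:
  assumes "is_library M \<rho>" "\<forall>A\<in>set (deduce_list M \<Gamma> \<rho> i). stmt M A"
    and "sched M (Suc i) = (k, m)"
  obtains C where "\<forall>A\<in>set C. stmt M A"
    "deduce_list M \<Gamma> \<rho> (Suc i) = deduce_list M \<Gamma> \<rho> i @ C"
    "run M (seq_term M \<rho> k) (rule_input M (deduce_list M \<Gamma> \<rho> i) \<rho> m)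
      = Some (lst M (deduce_list M \<Gamma> \<rho> (Suc i)))"
proof -
  have pos: "k > 0" "m > 0" using sched_pos[of "Suc i"] assms(3) by auto
  have "alg_seq M \<rho>" using assms(1) unfolding is_library_def by blast
  from rule_run[OF seq_term_rule(1)[OF assms(1) pos(1)] this assms(2) pos(2)]
  obtain C where C: "\<forall>A\<in>set C. stmt M A"
    "rule_output M (seq_term M \<rho> k) (deduce_list M \<Gamma> \<rho> i) \<rho> m = deduce_list M \<Gamma> \<rho> i @ C"
    "run M (seq_term M \<rho> k) (rule_input M (deduce_list M \<Gamma> \<rho> i) \<rho> m)
      = Some (lst M (deduce_list M \<Gamma> \<rho> i @ C))" by blast
  have "deduce_list M \<Gamma> \<rho> (Suc i) = deduce_list M \<Gamma> \<rho> i @ C"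
    using C(2) assms(3) by simp
  then show ?thesis using that C by metis
qed

lemma deduce_list_stmts:
  assumes "is_library M \<rho>" "\<forall>A\<in>set \<Gamma>. stmt M A"
  shows "\<forall>A\<in>set (deduce_list M \<Gamma> \<rho> i). stmt M A"
proof (induction i)
  case 0
  then show ?case using assms by simp
next
  case (Suc i)
  obtain k m where "sched M (Suc i) = (k, m)" by (rule prod.exhaust)
  from rule_run_deduce_list[OF assms(1) Suc this]
  obtain C where C: "\<forall>A\<in>set C. stmt M A"
    "deduce_list M \<Gamma> \<rho> (Suc i) = deduce_list M \<Gamma> \<rho> i @ C" by metis
  show ?case unfolding C(2) using Suc C(1) by auto
qed

lemma deduce_list_subset:
  assumes "is_library M \<rho>" "\<forall>A\<in>set \<Gamma>. stmt M A"
  shows "set \<Gamma> \<subseteq> set (deduce_list M \<Gamma> \<rho> i)"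
proof (induction i)
  case (Suc i)
  obtain k m where "sched M (Suc i) = (k, m)" by (rule prod.exhaust)
  from rule_run_deduce_list[OF assms(1) deduce_list_stmts[OF assms] this]
  obtain C where C: "deduce_list M \<Gamma> \<rho> (Suc i) = deduce_list M \<Gamma> \<rho> i @ C" by metis
  show ?case unfolding C using Suc by auto
qed simp

lemma deduce_list_true:
  assumes "is_library M \<rho>" "library_valid M \<rho>" "\<forall>A\<in>set \<Gamma>. true_stmt M A"
  shows "\<forall>A\<in>set (deduce_list M \<Gamma> \<rho> i). true_stmt M A"
proof (induction i)
  case 0
  then show ?case using assms by simp
next
  case (Suc i)
  obtain k m where km: "sched M (Suc i) = (k, m)" by (rule prod.exhaust)
  then have pos: "k > 0" "m > 0" using sched_pos[of "Suc i"] by auto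
  then have "rule_valid M \<rho> (seq_term M \<rho> k)"
    using assms(2) unfolding library_valid_def seq_terms_def by blast
  then show ?case using Suc pos unfolding rule_valid_def by (simp add: km)
qed

lemma true_stmt_imp_stmt: "true_stmt M A \<Longrightarrow> stmt M A"
  unfolding true_stmt_def stmt_def by blast

lemma valid_turnstile:
  assumes "is_library M \<rho>" "library_valid M \<rho>" "\<forall>A\<in>set \<Gamma>. true_stmt M A" "stmt M B"
    and "true_stmt M (turnstile M \<Gamma> \<rho> B)"
  shows "true_stmt M B"
proof -
  have "\<forall>A\<in>set \<Gamma>. stmt M A" using assms(3) true_stmt_imp_stmt by blast
  then obtain i where "B \<in> set (deduce_list M \<Gamma> \<rho> i)"
    using assms true_turnstile by blast
  then show ?thesis using deduce_list_true[OF assms(1-3)] by blast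
qed

text \<open>The schedule applies \<open>r\<close> with resource integer \<open>m\<close> at some
  step, to a list that still contains \<Gamma>. What else is on that list is unknown, so
  \<open>out\<close> ranges over all such \<open>H\<close>.\<close>

lemma turnstile_by_rule:
  assumes "is_library M \<rho>" "\<forall>A\<in>set \<Gamma>. stmt M A" "stmt M B" "r \<in> seq_terms M \<rho>" "m > 0"
    and out: "\<And>H. \<forall>A\<in>set H. stmt M A \<Longrightarrow> set \<Gamma> \<subseteq> set H \<Longrightarrow> B \<in> set (rule_output M r H \<rho> m)"
  shows "true_stmt M (turnstile M \<Gamma> \<rho> B)"
proof -
  obtain k where k: "k > 0" "r = seq_term M \<rho> k"
    using assms(4) unfolding seq_terms_def by blast
  obtain i where i: "sched M (Suc i) = (k, m)"
    by (rule sched_surj[of k m]) (use k assms(5) in auto)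
  have "B \<in> set (deduce_list M \<Gamma> \<rho> (Suc i))"
    using out[OF deduce_list_stmts[OF assms(1,2)] deduce_list_subset[OF assms(1,2)]] i k by simp
  then show ?thesis using true_turnstile[OF assms(2,1,3)] by blast
qed

text \<open>One application of \<open>P\<close> is enough. The resource integer 1 serves because the
  conclusions of a diagram depend only on \<open>H\<close> and \<rho>.\<close>

lemma diagram_P11_law:
  assumes "implements M P (diagram_P11 M)" "is_library M \<rho>" "P \<in> seq_terms M \<rho>"
    and "stmt M A" "stmt M B"
  shows "true_stmt M (turnstile M [neg_stmt M \<rho> (conj_stmt M A B)] \<rho>
    (disj_stmt M (neg_stmt M \<rho> A) (neg_stmt M \<rho> B)))"
proof (rule turnstile_by_rule[OF assms(2) _ stmt_disj assms(3), where m = 1])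
  fix H
  assume H: "\<forall>A\<in>set H. stmt M A" "set [neg_stmt M \<rho> (conj_stmt M A B)] \<subseteq> set H"
  have "alg_seq M \<rho>" using assms(2) unfolding is_library_def by blast
  then have "\<exists>C. run M P (rule_input M H \<rho> 1) = Some (lst M (H @ C)) \<and>
      set C = {Y. \<exists>Xs. (Xs, Y) \<in> diagram_P11 M \<rho> \<and> set Xs \<subseteq> set H}"
    using assms(1) H(1) unfolding implements_def by simp
  then obtain C where C: "run M P (rule_input M H \<rho> 1) = Some (lst M (H @ C))"
    "set C = {Y. \<exists>Xs. (Xs, Y) \<in> diagram_P11 M \<rho> \<and> set Xs \<subseteq> set H}" by blast
  have "disj_stmt M (neg_stmt M \<rho> A) (neg_stmt M \<rho> B) \<in> set C"
    unfolding C(2) diagram_P11_def using H(2) assms(4,5) by blast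
  then show "disj_stmt M (neg_stmt M \<rho> A) (neg_stmt M \<rho> B) \<in> set (rule_output M P H \<rho> 1)"
    using rule_output_eq[OF C(1)] by simp
qed (simp_all add: stmt_neg)

text \<open>A step is two runs of computed processes: \<rho> is run to get the scheduled rule, then
  this rule is run on the previous list. The recursion carries that list along.\<close>

lemma computable_deduce_list:
  assumes "is_library M \<rho>" "\<And>e. e \<in> D \<Longrightarrow> \<forall>A\<in>set (\<Gamma> e). stmt M A"
    and env: "computable_on (\<lambda>e. [code (s e)]) D (\<lambda>e. lcode (\<Gamma> e))"
  shows "computable_on (\<lambda>(i, e). [i, code (s e)]) (UNIV \<times> D)
    (\<lambda>(i, e). lcode (deduce_list M (\<Gamma> e) \<rho> i))"
proof (rule computable_primrec)
  show "computable_on (\<lambda>e. [code (s e)]) D (\<lambda>e. lcode (deduce_list M (\<Gamma> e) \<rho> 0))"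
    using env by simp
  let ?env = "\<lambda>(i, e). [i, lcode (deduce_list M (\<Gamma> e) \<rho> i), code (s e)]"
  let ?k = "\<lambda>e. fst (sched M (Suc (fst e)))" and ?m = "\<lambda>e. snd (sched M (Suc (fst e)))"
  let ?H = "\<lambda>e. deduce_list M (\<Gamma> (snd e)) \<rho> (fst e)"
  have i: "computable_on ?env (UNIV \<times> D) fst"
    by (rule computable_proj[where i = 0]) auto
  have H: "computable_on ?env (UNIV \<times> D) (\<lambda>e. lcode (?H e))"
    by (rule computable_proj[where i = 1]) auto
  have k: "computable_on ?env (UNIV \<times> D) ?k" and m: "computable_on ?env (UNIV \<times> D) ?m"
    by (intro computable_sched computable_Suc i; simp)+
  have "computable_on ?env (UNIV \<times> D) (\<lambda>e. code (seq_term M \<rho> (?k e)))"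
  proof (rule computable_run[OF computable_const computable_num[OF k]])
    fix e
    have "?k e > 0" using sched_pos[of "Suc (fst e)"] by simp
    then show "\<rho> \<in> algs M \<and> run M \<rho> (num M (?k e)) = Some (seq_term M \<rho> (?k e))"
      using seq_term_rule(2)[OF assms(1)] assms(1) unfolding is_library_def alg_seq_def by blast
  qed
  moreover have "computable_on ?env (UNIV \<times> D) (\<lambda>e. code (rule_input M (?H e) \<rho> (?m e)))"
    unfolding rule_input_def
    by (intro computable_cons computable_const computable_num m H)
  ultimately have "computable_on ?env (UNIV \<times> D)
      (\<lambda>e. lcode (deduce_list M (\<Gamma> (snd e)) \<rho> (Suc (fst e))))"
  proof (rule computable_run)
    fix e :: "nat \<times> 'a"
    assume e: "e \<in> UNIV \<times> D"
    have "?k e > 0" using sched_pos[of "Suc (fst e)"] by simp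
    then have "seq_term M \<rho> (?k e) \<in> algs M"
      using seq_term_rule(1)[OF assms(1)] unfolding is_rule_def by blast
    moreover have "\<forall>A\<in>set (\<Gamma> (snd e)). stmt M A" using assms(2) e by auto
    then obtain C where "run M (seq_term M \<rho> (?k e)) (rule_input M (?H e) \<rho> (?m e)) =
        Some (lst M (deduce_list M (\<Gamma> (snd e)) \<rho> (Suc (fst e))))"
      by (rule rule_run_deduce_list[OF assms(1) deduce_list_stmts[OF assms(1)]
            prod.collapse[symmetric]])
    ultimately show "seq_term M \<rho> (?k e) \<in> algs M \<and>
        run M (seq_term M \<rho> (?k e)) (rule_input M (?H e) \<rho> (?m e)) =
        Some (lst M (deduce_list M (\<Gamma> (snd e)) \<rho> (Suc (fst e))))" by blast
  qed
  then show "computable_on ?env (UNIV \<times> D)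
      (\<lambda>(i, e). lcode (deduce_list M (\<Gamma> e) \<rho> (Suc i)))"
    by (rule computable_on_cong) auto
qed

section \<open>Diagonalization\<close>

definition diag_stmt :: "nat \<Rightarrow> 'd \<Rightarrow> 'd" where
  "diag_stmt v a = lst M [a, a, num M v]"

definition diag_conj :: "'d \<Rightarrow> 'd" where
  "diag_conj a = conj_stmt M (diag_stmt 0 a) (diag_stmt 1 a)"

lemma stmt_diag: "a \<in> algs M \<Longrightarrow> stmt M (diag_stmt v a)"
  unfolding diag_stmt_def by (rule stmt_triple)

text \<open>A process has at most one output, and the numerals 0 and 1 differ.\<close>

lemma diag_conj_not_true:
  assumes "a \<in> algs M"
  shows "\<not> true_stmt M (diag_conj a)"
  unfolding diag_conj_def true_conj[OF stmt_diag[OF assms] stmt_diag[OF assms]]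
  unfolding diag_stmt_def true_triple by auto

lemma computable_diag_stmt:
  assumes "computable_on env D (\<lambda>e. code (a e))"
  shows "computable_on env D (\<lambda>e. code (diag_stmt v (a e)))"
  unfolding diag_stmt_def by (intro computable_cons computable_const assms)

text \<open>Bounding the codes by the resource integer makes the search for an instance finite and the
  rule monotone.\<close>

definition diag_conclusions :: "'d list \<Rightarrow> nat \<Rightarrow> 'd list" where
  "diag_conclusions H m =
    (if \<exists>c<m. decode c \<in> algs M \<and> diag_conj (decode c) \<in> set H then [falsum M] else [])"

lemma diag_rule_exists:
  obtains r where "is_rule M r"
    "\<And>H \<rho> m. rule_output M r H \<rho> m = H @ diag_conclusions H m"
proof -
  \<comment> \<open>Decidability is proved for the tuple of \<open>H\<close> and \<open>m\<close>
    and then carried over to every environment that computes both, in particular to the coded input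
    of the rule.\<close>
  have dec: "decidable_on env D
      (\<lambda>e. \<exists>c<m e. decode c \<in> algs M \<and> diag_conj (decode c) \<in> set (H e))"
    if "computable_on env D (\<lambda>e. lcode (H e))" "computable_on env D m"
    for env and D :: "'e set" and H m
  proof -
    let ?env = "\<lambda>(H, m). [lcode H, m]" and ?env' = "\<lambda>(c, e). c # (case e of (H, m) \<Rightarrow> [lcode H, m])"
    have c: "computable_on ?env' (UNIV \<times> UNIV) (\<lambda>e. code (decode (fst e)))"
      by (rule computable_proj[where i = 0]) auto
    have H: "computable_on ?env' (UNIV \<times> UNIV) (\<lambda>e. lcode (fst (snd e)))"
      by (rule computable_proj[where i = 1]) auto
    have "decidable_on ?env' (UNIV \<times> UNIV)
        (\<lambda>e. code (decode (fst e)) \<in> code ` algs M \<and> diag_conj (decode (fst e)) \<in> set (fst (snd e)))"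
      unfolding diag_conj_def conj_stmt_def
      by (intro decidable_conj decidable_recursive_set algs_rec decidable_member computable_cons
          computable_diag_stmt computable_const c H)
    then have "decidable_on ?env' (UNIV \<times> UNIV)
        (\<lambda>(c, e). decode c \<in> algs M \<and> diag_conj (decode c) \<in> set (fst e))"
      by (rule computable_on_cong) (auto simp: image_iff)
    from decidable_ex_less[OF _ _ this,
        OF computable_proj[where i = 1] computable_proj[where i = 2], of snd]
    have "decidable_on ?env UNIV
        (\<lambda>e. \<exists>c<snd e. decode c \<in> algs M \<and> diag_conj (decode c) \<in> set (fst e))"
      by (simp add: case_prod_unfold)
    then have "computable_on ?env UNIV
        (\<lambda>(H, m). of_bool (\<exists>c<m. decode c \<in> algs M \<and> diag_conj (decode c) \<in> set H))"
      by (rule computable_on_cong) auto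
    from computable_compose2[where t = "\<lambda>m. m", OF this that] show ?thesis by simp
  qed
  let ?env = "\<lambda>(H, \<rho>, m). [code (rule_input M H \<rho> m)]"
  have input: "computable_on ?env UNIV (\<lambda>e. lcode [lst M (fst e), fst (snd e), num M (snd (snd e))])"
    by (rule computable_proj[where i = 0]) (auto simp: rule_input_def)
  have H: "computable_on ?env UNIV (\<lambda>e. lcode (fst e))"
    using computable_hd[OF input] by simp
  have "computable_on ?env UNIV (\<lambda>e. code (num M (snd (snd e))))"
    using computable_hd[OF computable_tl[OF computable_tl[OF input]]] by simp
  then have m: "computable_on ?env UNIV (\<lambda>e. snd (snd e))"
    by (rule computable_unnum)
  \<comment> \<open>The double reversal appends \<open>falsum M\<close> at the end, so that
    \<open>H\<close> stays an initial sublist.\<close>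
  have "computable_on ?env UNIV (\<lambda>e. if \<exists>c<snd (snd e). decode c \<in> algs M \<and>
      diag_conj (decode c) \<in> set (fst e)
      then lcode (rev (falsum M # rev (fst e))) else lcode (fst e))"
    by (intro computable_if dec computable_rev computable_cons computable_const H m)
  then have "computable_on (\<lambda>e. [code (case e of (H, \<rho>, m) \<Rightarrow> rule_input M H \<rho> m)]) UNIV
      (\<lambda>e. lcode (fst e @ diag_conclusions (fst e) (snd (snd e))))"
    by (simp add: diag_conclusions_def case_prod_unfold if_distrib cong: if_cong)
  from algorithm_exists[OF this] obtain r where r: "r \<in> algs M"
    "\<And>H \<rho> m. run M r (rule_input M H \<rho> m) = Some (lst M (H @ diag_conclusions H m))"
    by auto
  have out: "rule_output M r H \<rho> m = H @ diag_conclusions H m" for H \<rho> m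
    by (rule rule_output_eq[OF r(2)])
  have "is_rule M r"
    unfolding is_rule_def
  proof (intro conjI allI impI)
    show "r \<in> algs M" by (rule r(1))
    show "\<exists>C. (\<forall>A\<in>set C. stmt M A) \<and> run M r (rule_input M H \<rho> m) = Some (lst M (H @ C))"
      for H \<rho> m
      by (rule exI[of _ "diag_conclusions H m"])
        (auto simp: r(2) diag_conclusions_def stmt_falsum)
    fix H H' :: "'d list" and \<rho> and m m' :: nat
    assume "(\<forall>A\<in>set H. stmt M A) \<and> (\<forall>A\<in>set H'. stmt M A) \<and> alg_seq M \<rho> \<and> 0 < m \<and> m \<le> m' \<and>
      set H \<subseteq> set H'"
    then have "m \<le> m'" "set H \<subseteq> set H'" by auto
    then have "\<exists>c<m'. decode c \<in> algs M \<and> diag_conj (decode c) \<in> set H'"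
      if "\<exists>c<m. decode c \<in> algs M \<and> diag_conj (decode c) \<in> set H"
      using that by (meson less_le_trans subsetD)
    then have "set (diag_conclusions H m) \<subseteq> set (diag_conclusions H' m')"
      unfolding diag_conclusions_def by auto
    then show "set (rule_output M r H \<rho> m) \<subseteq> set (rule_output M r H' \<rho> m')"
      using \<open>set H \<subseteq> set H'\<close> by (auto simp: out)
  qed
  then show ?thesis using out that by blast
qed

section \<open>Enumerating a base together with one more rule\<close>

lemma computable_prepend:
  assumes "computable_on (\<lambda>n. [n]) UNIV (\<lambda>n. code (s n))"
  shows "computable_on (\<lambda>n. [n]) UNIV (\<lambda>n. code (case_nat r s n))"
proof -
  \<comment> \<open>The case distinction on the index is again a recursion that discards the
    previous value.\<close>
  have "computable_on (\<lambda>(n, e). n # []) (UNIV \<times> UNIV) (\<lambda>(n, e :: unit). code (case_nat r s n))"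
  proof (rule computable_primrec)
    have "computable_on (\<lambda>(n, e). [n, code (case_nat r s n)]) (UNIV \<times> UNIV)
        (\<lambda>e :: nat \<times> unit. code (s (fst e)))"
      by (rule computable_compose1[where s = "\<lambda>n. n", OF assms computable_proj[where i = 0]]) auto
    then show "computable_on (\<lambda>(n, e). [n, code (case_nat r s n)]) (UNIV \<times> UNIV)
        (\<lambda>(n, e :: unit). code (case_nat r s (Suc n)))"
      by (rule computable_on_cong) auto
  qed (simp add: computable_const)
  from computable_compose[OF this, where ks = "[\<lambda>n. n]" and h = "\<lambda>n. (n, ())" and D = UNIV
      and env = "\<lambda>n. [n]"]
  show ?thesis using computable_proj[where i = 0 and env = "\<lambda>n. [n]" and f = "\<lambda>n. n"] by simp
qed

lemma range_case_nat: "range (case_nat r s) = insert r (range s)"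
proof -
  have "case_nat r s n \<in> insert r (range s)" for n by (cases n) auto
  moreover have "r = case_nat r s 0" "s n = case_nat r s (Suc n)" for n by simp_all
  ultimately show ?thesis by (metis image_subsetI insert_subset rangeI subset_antisym)
qed

lemma extended_library_exists:
  assumes "is_base M \<B>" "is_rule M r"
  obtains \<rho> where "is_library M \<rho>" "seq_terms M \<rho> = insert r \<B>"
proof -
  have "\<exists>s. computable_on (\<lambda>n. [n]) UNIV (\<lambda>n. code (s n)) \<and> range s = insert r \<B>"
  proof (cases "finite \<B>")
    case True
    then show ?thesis
    proof (induction \<B>)
      case empty
      \<comment> \<open>The constant sequence \<open>r\<close> starts the induction, which covers
        the empty base as well.\<close>
      show ?case by (rule exI[of _ "\<lambda>n. r"]) (auto simp: computable_const)
    next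
      case (insert b F)
      then obtain s where "computable_on (\<lambda>n. [n]) UNIV (\<lambda>n. code (s n))" "range s = insert r F"
        by blast
      then show ?case
        using computable_prepend[of s b] range_case_nat[of b s] by (metis insert_commute)
    qed
  next
    case False
    then obtain \<sigma> where \<sigma>: "is_library M \<sigma>" "\<B> = seq_terms M \<sigma>"
      using assms(1) unfolding is_base_def by blast
    \<comment> \<open>Libraries are indexed from 1, the auxiliary sequences from 0.\<close>
    let ?s = "\<lambda>n. seq_term M \<sigma> (Suc n)"
    have "computable_on (\<lambda>n. [n]) UNIV (\<lambda>n. code (?s n))"
      by (rule computable_run[OF computable_const
            computable_num[OF computable_Suc[OF computable_proj[where i = 0 and f = "\<lambda>n. n"]]]])
        (use \<sigma>(1) seq_term_rule(2)[OF \<sigma>(1)] in \<open>auto simp: is_library_def alg_seq_def\<close>)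
    moreover have "range ?s = \<B>"
      unfolding \<sigma>(2) seq_terms_def by (auto simp: image_iff) (metis Suc_pred)
    ultimately show ?thesis using computable_prepend[of ?s r] range_case_nat[of r ?s] by metis
  qed
  then obtain s where s: "computable_on (\<lambda>n. [n]) UNIV (\<lambda>n. code (s n))" "range s = insert r \<B>"
    by blast
  have "computable_on (\<lambda>n. [code (num M n)]) UNIV (\<lambda>n. n)"
    by (rule computable_unnum, rule computable_proj[where i = 0]) auto
  \<comment> \<open>The index is shifted back; the value at 0 does not matter for a library.\<close>
  from computable_compose1[where s = "\<lambda>n. n", OF s(1) computable_pred[OF this]]
  have "computable_on (\<lambda>n. [code (num M n)]) UNIV (\<lambda>n. code (s (n - 1)))" by simp
  from algorithm_exists[OF this] obtain \<rho> where \<rho>: "\<rho> \<in> algs M"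
    "\<And>n. run M \<rho> (num M n) = Some (s (n - 1))" by auto
  then have "seq_terms M \<rho> = {s (n - 1) | n. n > 0}"
    unfolding seq_terms_def seq_term_def by simp
  also have "\<dots> = range s"
    by (auto simp: image_iff intro: exI[of _ "Suc _"])
  finally have terms: "seq_terms M \<rho> = insert r \<B>" using s(2) by simp
  moreover have "is_library M \<rho>"
    unfolding is_library_def alg_seq_def halts_def terms
    using \<rho> assms unfolding is_base_def by auto
  ultimately show ?thesis using that by blast
qed

text \<open>Otherwise the search for a refutation halts on every algorithm and yields an algorithm
  that, run on itself, makes the refuted statement true.\<close>

lemma diagonal_not_all_refuted:
  assumes lib: "is_library M \<rho>" and valid: "library_valid M \<rho>"
  shows "\<exists>a\<in>algs M. \<not> true_stmt M (neg_stmt M \<rho> (diag_stmt 0 a)) \<and>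
    \<not> true_stmt M (neg_stmt M \<rho> (diag_stmt 1 a))"
proof (rule ccontr)
  assume "\<not> ?thesis"
  then have neg: "true_stmt M (neg_stmt M \<rho> (diag_stmt 0 a)) \<or>
      true_stmt M (neg_stmt M \<rho> (diag_stmt 1 a))" if "a \<in> algs M" for a
    using that by blast
  define R where "R v i a \<longleftrightarrow> falsum M \<in> set (deduce_list M [diag_stmt v a] \<rho> i)" for v i a
  have "\<exists>i. R v i a" if "a \<in> algs M" "true_stmt M (neg_stmt M \<rho> (diag_stmt v a))" for v a
    using that true_turnstile[OF _ lib stmt_falsum, of "[diag_stmt v a]"] stmt_diag[OF that(1)]
    unfolding neg_stmt_def imp_stmt_def R_def by auto
  then have ex: "\<exists>i. R 0 i a \<or> R 1 i a" if "a \<in> algs M" for a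
    using neg[OF that] that by blast
  \<comment> \<open>A valid library never leads from a true statement to
    \<open>falsum M\<close>.\<close>
  have consistent: "\<not> R v i a" if "true_stmt M (diag_stmt v a)" for v i a
    using deduce_list_true[OF lib valid, of "[diag_stmt v a]" i] that falsum_not_true
    unfolding R_def by auto
  let ?env = "\<lambda>(i, a). [i, code a]"
  have R: "decidable_on ?env (UNIV \<times> algs M) (\<lambda>e. R v (fst e) (snd e))" for v
  proof -
    have "computable_on ?env (UNIV \<times> algs M)
        (\<lambda>(i, a). lcode (deduce_list M [diag_stmt v a] \<rho> i))"
    proof (rule computable_deduce_list[OF lib])
      have "computable_on (\<lambda>a. [code a]) (algs M) code"
        by (rule computable_proj[where i = 0]) auto
      then show "computable_on (\<lambda>a. [code a]) (algs M) (\<lambda>a. lcode [diag_stmt v a])"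
        by (intro computable_cons computable_diag_stmt computable_const)
    qed (simp add: stmt_diag)
    then have "computable_on ?env (UNIV \<times> algs M)
        (\<lambda>e. lcode (deduce_list M [diag_stmt v (snd e)] \<rho> (fst e)))"
      by (rule computable_on_cong) auto
    then show ?thesis unfolding R_def by (intro decidable_member computable_const)
  qed
  \<comment> \<open>The first step with a refutation; if both statements are refuted there, the
    output is 0.\<close>
  let ?i = "\<lambda>a. LEAST i. R 0 i a \<or> R 1 i a"
  have "decidable_on ?env (UNIV \<times> algs M) (\<lambda>(i, a). R 0 i a \<or> R 1 i a)"
    using decidable_disj[OF R[of 0] R[of 1]] by (rule computable_on_cong) auto
  then have i: "computable_on (\<lambda>a. [code a]) (algs M) ?i"
    by (rule computable_Least) (rule ex)
  have "decidable_on ?env (UNIV \<times> algs M) (\<lambda>(i, a). R 0 i a)"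
    using R[of 0] by (rule computable_on_cong) auto
  then have "decidable_on (\<lambda>a. [code a]) (algs M) (\<lambda>a. case (?i a, a) of (i, a) \<Rightarrow> R 0 i a)"
  proof (rule computable_compose[where ks = "[?i, code]"])
    fix k assume "k \<in> set [?i, code]"
    then show "computable_on (\<lambda>a. [code a]) (algs M) k"
      using i computable_proj[where i = 0 and env = "\<lambda>a. [code a]" and f = code] by auto
  qed simp_all
  then have "decidable_on (\<lambda>a. [code a]) (algs M) (\<lambda>a. R 0 (?i a) a)"
    by (simp only: split_conv)
  then have "computable_on (\<lambda>a. [code a]) (algs M)
      (\<lambda>a. code (num M (if R 0 (?i a) a then 0 else 1)))"
    by (intro computable_num computable_if computable_const)
  \<comment> \<open>The algorithm answers on every algorithm \<open>b\<close>; below,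
    \<open>b\<close> is \<open>a\<close> itself.\<close>
  from algorithm_exists[OF this] obtain a where a: "a \<in> algs M"
    "\<And>b. b \<in> algs M \<Longrightarrow> run M a b = Some (num M (if R 0 (?i b) b then 0 else 1))" by blast
  have "R 0 (?i a) a \<or> R 1 (?i a) a" using ex[OF a(1)] by (rule LeastI_ex)
  moreover have answer: "true_stmt M (diag_stmt (if R 0 (?i a) a then 0 else 1) a)"
    unfolding diag_stmt_def true_triple using a by blast
  moreover have "\<not> R 0 (?i a) a"
  proof
    assume R0: "R 0 (?i a) a"
    then have "true_stmt M (diag_stmt 0 a)" using answer by (simp only: if_True)
    then show False using consistent R0 by blast
  qed
  ultimately have "R 1 (?i a) a" "true_stmt M (diag_stmt 1 a)" by (simp_all only: if_False simp_thms)
  then show False using consistent by blast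
qed

lemma no_stable_base_with_law:
  assumes stable: "stable_base M \<B>"
    and law: "\<And>\<rho> A B. base_library M \<B> \<rho> \<Longrightarrow> stmt M A \<Longrightarrow> stmt M B \<Longrightarrow>
      true_stmt M (turnstile M [neg_stmt M \<rho> (conj_stmt M A B)] \<rho>
        (disj_stmt M (neg_stmt M \<rho> A) (neg_stmt M \<rho> B)))"
  shows False
proof -
  obtain r where r: "is_rule M r" "\<And>H \<rho> m. rule_output M r H \<rho> m = H @ diag_conclusions H m"
    by (rule diag_rule_exists) blast
  have "is_base M \<B>" using stable unfolding stable_base_def by blast
  then obtain \<rho> where \<rho>: "is_library M \<rho>" "seq_terms M \<rho> = insert r \<B>"
    by (rule extended_library_exists[OF _ r(1)])
  \<comment> \<open>The new conclusion appears only if some \<open>diag_conj\<close> is on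
    \<open>H\<close>, which cannot happen when \<open>H\<close> consists of true statements.\<close>
  have "rule_valid M \<rho> r"
    unfolding rule_valid_def r(2) diag_conclusions_def using diag_conj_not_true by auto
  moreover have base: "base_library M \<B> \<rho>" using \<rho> unfolding base_library_def by auto
  ultimately have "valid_outside M \<B> \<rho>" unfolding valid_outside_def \<rho>(2) by blast
  then have valid: "library_valid M \<rho>"
    using stable base unfolding stable_base_def by blast
  obtain a where a: "a \<in> algs M" "\<not> true_stmt M (neg_stmt M \<rho> (diag_stmt 0 a))"
    "\<not> true_stmt M (neg_stmt M \<rho> (diag_stmt 1 a))"
    using diagonal_not_all_refuted[OF \<rho>(1) valid] by blast
  \<comment> \<open>The search in \<open>r\<close> covers codes strictly below the resource integer,
    so \<open>Suc (code a)\<close> is the least one that reaches \<open>a\<close>.\<close>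
  have "true_stmt M (neg_stmt M \<rho> (diag_conj a))"
    unfolding neg_stmt_def imp_stmt_def
  proof (rule turnstile_by_rule[OF \<rho>(1) _ stmt_falsum, where r = r and m = "Suc (code a)"])
    fix H
    assume "set [diag_conj a] \<subseteq> set H"
    then have "\<exists>c<Suc (code a). decode c \<in> algs M \<and> diag_conj (decode c) \<in> set H"
      using a(1) by (intro exI[of _ "code a"]) auto
    then show "falsum M \<in> set (rule_output M r H \<rho> (Suc (code a)))"
      by (simp add: r(2) diag_conclusions_def)
  qed (simp_all add: \<rho>(2) diag_conj_def stmt_conj)
  \<comment> \<open>Validity of \<rho> turns the derivation supplied by the law, whose premise is
    now true, into the truth of its conclusion.\<close>
  then have "true_stmt M (disj_stmt M (neg_stmt M \<rho> (diag_stmt 0 a)) (neg_stmt M \<rho> (diag_stmt 1 a)))"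
    using valid_turnstile[OF \<rho>(1) valid _ stmt_disj law[OF base stmt_diag[OF a(1)] stmt_diag[OF a(1)]]]
    unfolding diag_conj_def by simp
  then show False using a true_disj[OF stmt_neg stmt_neg] by blast
qed

end

theorem theorem14p12:
  fixes M :: "'d model"
  assumes "framework M"
  shows "\<not> (\<exists>\<B>. stable_base M \<B> \<and>
            (\<forall>\<rho>. base_library M \<B> \<rho> \<longrightarrow>
              (\<forall>A B. stmt M A \<and> stmt M B \<longrightarrow>
                true_stmt M (turnstile M [neg_stmt M \<rho> (conj_stmt M A B)] \<rho>
                               (disj_stmt M (neg_stmt M \<rho> A) (neg_stmt M \<rho> B))))))
       \<and> (\<forall>P. implements M P (diagram_P11 M) \<longrightarrow>
            \<not> (\<exists>\<B>. stable_base M \<B> \<and> P \<in> \<B>))"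
proof -
  interpret framework M by (rule assms)
  obtain code where "coded_framework M code"
    using recursive framework_axioms
    unfolding recursive_model_def coded_framework_def coded_framework_axioms_def by blast
  then interpret coded_framework M code .
  \<comment> \<open>A base containing \<open>P\<close> puts it into each of its libraries, so the
    law holds for all of them.\<close>
  have "\<not> (stable_base M \<B> \<and> P \<in> \<B>)" if "implements M P (diagram_P11 M)" for P \<B>
    using no_stable_base_with_law diagram_P11_law[OF that] unfolding base_library_def by blast
  then show ?thesis using no_stable_base_with_law by blast
qed

end
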